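(* $T$-local compactness is a topological property: if $X$ and $Y$ are homeomorphic topological spaces and $X$ is $T$-locally compact, then $Y$ is $T$-locally compact.
   Context: A topological space $X$ is called $T$-locally compact at $x \in X$ if for every open set $U$ containing $x$ there exists an open subset $V$ of $X$ containing $x$ such that the boundary $\partial V$ is compact and $V \subseteq U$. The space $X$ is called $T$-locally compact if it is $T$-locally compact at each of its points. Compactness does not include the Hausdorff condition. *)

theory Defs
  imports "HOL-Analysis.Analysis"
begin

(* Only meaningful for x in the underlying set of X; vacuously true for other x. *)
definition T_locally_compact_at :: "'a topology \<Rightarrow> 'a \<Rightarrow> bool" where
  "T_locally_compact_at X x \<longleftrightarrow>
     (\<forall>U. openin X U \<and> x \<in> U \<longrightarrow>
        (\<exists>V. openin X V \<and> x \<in> V \<and> compactin X (X frontier_of V) \<and> V \<subseteq> U))"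

definition T_locally_compact_space :: "'a topology \<Rightarrow> bool" where
  "T_locally_compact_space X \<longleftrightarrow> (\<forall>x \<in> topspace X. T_locally_compact_at X x)"

end

theory Submission
  imports Defs
begin

text \<open>
  The condition at a point only mentions open sets, inclusion, frontiers and compactness, and a
  homeomorphism \<open>f\<close> from \<open>X\<close> to \<open>Y\<close> preserves all of them. An open \<open>U\<close> around \<open>f x\<close> therefore
  pulls back to an open set around \<open>x\<close>; if \<open>V\<close> is a neighbourhood with compact frontier inside that
  preimage, its image \<open>f ` V\<close> is an open set around \<open>f x\<close> inside \<open>U\<close>, and its frontier is
  \<open>f ` (X frontier_of V)\<close>, the image of a compact set. So the condition transfers from each \<open>x\<close>
  to \<open>f x\<close>, and surjectivity of \<open>f\<close> reaches every point of \<open>Y\<close>.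
\<close>

lemma homeomorphic_map_T_locally_compact_at:
  assumes hom: "homeomorphic_map X Y f"
    and x: "x \<in> topspace X"
    and loc: "T_locally_compact_at X x"
  shows "T_locally_compact_at Y (f x)"
  unfolding T_locally_compact_at_def
proof (intro allI impI, elim conjE)
  fix U
  assume U: "openin Y U" "f x \<in> U"
  have "openin X {z \<in> topspace X. f z \<in> U}"
    using hom U(1) homeomorphic_imp_continuous_map openin_continuous_map_preimage by blast
  then obtain V where V: "openin X V" "x \<in> V" "compactin X (X frontier_of V)"
      "V \<subseteq> {z \<in> topspace X. f z \<in> U}"
    using loc x U(2) unfolding T_locally_compact_at_def by blast
  have sub: "V \<subseteq> topspace X"
    using V(1) by (rule openin_subset)
  have "openin Y (f ` V)"
    using homeomorphic_map_openness[OF hom sub] V(1) by blast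
  moreover have "compactin Y (Y frontier_of (f ` V))"
    using homeomorphic_map_compactness[OF hom frontier_of_subset_topspace]
      homeomorphic_map_frontier_of[OF hom sub] V(3) by metis
  ultimately show "\<exists>W. openin Y W \<and> f x \<in> W \<and> compactin Y (Y frontier_of W) \<and> W \<subseteq> U"
    using V(2,4) by blast
qed

theorem theorem8:
  fixes X :: "'a topology" and Y :: "'b topology"
  assumes "X homeomorphic_space Y"
    and "T_locally_compact_space X"
  shows "T_locally_compact_space Y"
proof -
  obtain f where f: "homeomorphic_map X Y f"
    using assms(1) homeomorphic_space by blast
  have "topspace Y = f ` topspace X"
    using homeomorphic_imp_surjective_map[OF f] by simp
  then show ?thesis
    using assms(2) homeomorphic_map_T_locally_compact_at[OF f]
    unfolding T_locally_compact_space_def by auto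
qed

end
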